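(* Let $H$ be a real or complex Hilbert space, let $A$ be the generator of a $C_0$-semigroup in $H$ with domain $D(A)$, and let $P \in L(H)$ be an orthogonal projection. If $\operatorname{Re}\langle PAx, x\rangle \leq 0$ for all $x \in D(A)$, then $(A,P)$ is locally passive.
   Context: $L(H)$ denotes the bounded linear operators on $H$. Let $H$ be a real or complex Hilbert space with inner product $\langle\cdot,\cdot\rangle$ (if $H$ is real, $\operatorname{Re}$ is superfluous), $A$ the generator of a $C_0$-semigroup $S$ in $H$, and $P$ a (bounded linear) projection on $H$. For $T>0$ and $u\in C([0,T],H)$, the mild solution of $\dot x(t) = Ax(t)+Pu(t)$, $x(0)=0$, is $x(t) = \int_0^t S(t-s)Pu(s)\,ds$, $t\in[0,T]$. The pair $(A,P)$ is called locally passive if for all $T>0$ and $u \in C([0,T],H)$ the mild solution $x \in C([0,T],H)$ of $\dot x(t) = Ax(t)+Pu(t)$, $x(0)=0$, satisfies $$W_T(u) := \operatorname{Re}\int_0^T \langle x(t), P u(t)\rangle\, dt \geq 0.$$ *)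

theory Defs
  imports "HOL-Analysis.Analysis"
begin

text \<open>
  The scalar field is a type variable of the following class, whose members are, up to the
  isometric field isomorphism \<^emph>\<open>to_complex\<close>, exactly the real and the complex numbers. (Completeness,
  contained in \<^class>\<open>banach\<close>, is no further restriction; it makes the library's
  integration theory applicable to scalar-valued functions.)
\<close>

class real_or_complex = real_normed_field + banach +
  fixes to_complex :: "'a \<Rightarrow> complex"
  assumes to_complex_add: "to_complex (a + b) = to_complex a + to_complex b"
    and to_complex_mult: "to_complex (a * b) = to_complex a * to_complex b"
    and to_complex_scaleR: "to_complex (r *\<^sub>R a) = r *\<^sub>R to_complex a"
    and norm_to_complex: "norm (to_complex a) = norm a"
    and range_to_complex: "range to_complex = \<real> \<or> range to_complex = UNIV"

instantiation real :: real_or_complex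
begin

definition to_complex_real :: "real \<Rightarrow> complex"
  where "to_complex_real = complex_of_real"

instance
  by standard (auto simp: to_complex_real_def scaleR_conv_of_real Reals_def)

end

instantiation complex :: real_or_complex
begin

definition to_complex_complex :: "complex \<Rightarrow> complex"
  where "to_complex_complex a = a"

instance
  by standard (auto simp: to_complex_complex_def)

end

text \<open>
  A Hilbert space over the scalars \<^emph>\<open>'k\<close>. Completeness is part of \<^class>\<open>banach\<close>; the axiom
  \<^emph>\<open>norm_sq\<close> states that the norm of the type is the one induced by the inner product, which also
  yields positive definiteness. The inner product is linear in its first argument.
\<close>

locale hilbert_space = vector_space scl
  for scl :: "'k::real_or_complex \<Rightarrow> 'h::banach \<Rightarrow> 'h" +
  fixes ip :: "'h \<Rightarrow> 'h \<Rightarrow> 'k"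
  assumes scale_of_real: "scl (of_real r) x = r *\<^sub>R x"
    and ip_add_left: "ip (x + y) z = ip x z + ip y z"
    and ip_scale_left: "ip (scl c x) y = c * ip x y"
    and ip_commute: "to_complex (ip y x) = cnj (to_complex (ip x y))"
    and norm_sq: "ip x x = of_real ((norm x)\<^sup>2)"

lemma hilbert_space_real_inner:
  "hilbert_space (scaleR :: real \<Rightarrow> 'h \<Rightarrow> 'h::{real_inner, banach}) inner"
  by unfold_locales
    (auto simp: algebra_simps inner_add_left to_complex_real_def inner_commute power2_norm_eq_inner)

lemma hilbert_space_complex:
  "hilbert_space (\<lambda>c x :: complex. c * x) (\<lambda>x y. x * cnj y)"
  by unfold_locales
    (auto simp: algebra_simps to_complex_complex_def scaleR_conv_of_real
        simp flip: complex_norm_square)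

definition bounded_operator ::
    "('k::real_or_complex \<Rightarrow> 'h::banach \<Rightarrow> 'h) \<Rightarrow> ('h \<Rightarrow> 'h) \<Rightarrow> bool"
  where "bounded_operator scl F \<longleftrightarrow>
    bounded_linear F \<and> (\<forall>c x. F (scl c x) = scl c (F x))"

definition orthogonal_projection ::
    "('k::real_or_complex \<Rightarrow> 'h::banach \<Rightarrow> 'h) \<Rightarrow> ('h \<Rightarrow> 'h \<Rightarrow> 'k) \<Rightarrow> ('h \<Rightarrow> 'h) \<Rightarrow> bool"
  where "orthogonal_projection scl ip P \<longleftrightarrow>
    bounded_operator scl P \<and> P \<circ> P = P \<and>
    (\<forall>x\<in>range P. \<forall>y. P y = 0 \<longrightarrow> ip x y = 0)"

text \<open>Only the values \<^emph>\<open>S t\<close> for \<^emph>\<open>t \<ge> 0\<close> are meaningful.\<close>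

definition C0_semigroup ::
    "('k::real_or_complex \<Rightarrow> 'h::banach \<Rightarrow> 'h) \<Rightarrow> (real \<Rightarrow> 'h \<Rightarrow> 'h) \<Rightarrow> bool"
  where "C0_semigroup scl S \<longleftrightarrow>
    (\<forall>t\<ge>0. bounded_operator scl (S t)) \<and>
    S 0 = id \<and>
    (\<forall>s\<ge>0. \<forall>t\<ge>0. S (s + t) = S s \<circ> S t) \<and>
    (\<forall>x. ((\<lambda>t. S t x) \<longlongrightarrow> x) (at_right 0))"

text \<open>An unbounded operator is a partial map \<^emph>\<open>A\<close>, with domain \<^emph>\<open>D(A) = dom A\<close>.\<close>

definition generator :: "(real \<Rightarrow> 'h::banach \<Rightarrow> 'h) \<Rightarrow> 'h \<rightharpoonup> 'h"
  where "generator S x =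
    (if \<exists>y. ((\<lambda>t. (S t x - x) /\<^sub>R t) \<longlongrightarrow> y) (at_right 0)
     then Some (Lim (at_right 0) (\<lambda>t. (S t x - x) /\<^sub>R t)) else None)"

lemma generator_eq_Some_iff:
  "generator S x = Some y \<longleftrightarrow> ((\<lambda>t. (S t x - x) /\<^sub>R t) \<longlongrightarrow> y) (at_right 0)"
  by (auto simp: generator_def tendsto_Lim
      intro: tendsto_unique[OF trivial_limit_at_right_real])

definition generates ::
    "('k::real_or_complex \<Rightarrow> 'h::banach \<Rightarrow> 'h) \<Rightarrow> ('h \<rightharpoonup> 'h) \<Rightarrow> (real \<Rightarrow> 'h \<Rightarrow> 'h) \<Rightarrow> bool"
  where "generates scl A S \<longleftrightarrow> C0_semigroup scl S \<and> generator S = A"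

definition mild_solution ::
    "(real \<Rightarrow> 'h::banach \<Rightarrow> 'h) \<Rightarrow> ('h \<Rightarrow> 'h) \<Rightarrow> (real \<Rightarrow> 'h) \<Rightarrow> real \<Rightarrow> 'h"
  where "mild_solution S P u t = integral {0..t} (\<lambda>s. S (t - s) (P (u s)))"

definition work ::
    "('h::banach \<Rightarrow> 'h \<Rightarrow> 'k::real_or_complex) \<Rightarrow> (real \<Rightarrow> 'h \<Rightarrow> 'h) \<Rightarrow> ('h \<Rightarrow> 'h) \<Rightarrow> real
      \<Rightarrow> (real \<Rightarrow> 'h) \<Rightarrow> real"
  where "work ip S P T u =
    Re (to_complex (integral {0..T} (\<lambda>t. ip (mild_solution S P u t) (P (u t)))))"

text \<open>
  For \<^emph>\<open>t \<ge> 0\<close> the semigroup is uniquely determined by its generator, so for a generator \<^emph>\<open>A\<close>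
  the quantifier over \<^emph>\<open>S\<close> just names the semigroup generated by \<^emph>\<open>A\<close>. The notion is only
  used for such \<^emph>\<open>A\<close>.
\<close>

definition locally_passive ::
    "('k::real_or_complex \<Rightarrow> 'h::banach \<Rightarrow> 'h) \<Rightarrow> ('h \<Rightarrow> 'h \<Rightarrow> 'k) \<Rightarrow> ('h \<rightharpoonup> 'h) \<Rightarrow> ('h \<Rightarrow> 'h)
      \<Rightarrow> bool"
  where "locally_passive scl ip A P \<longleftrightarrow>
    (\<forall>S. generates scl A S \<longrightarrow>
      (\<forall>T>0. \<forall>u. continuous_on {0..T} u \<longrightarrow> 0 \<le> work ip S P T u))"

end

theory Submission
  imports Defs
begin

text \<open>
  The dissipation condition on \<open>D(A)\<close> is a statement about the semigroup \<open>S\<close> seen through \<open>P\<close>. For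
  \<open>x \<in> D(A)\<close> the orbit \<open>S t x\<close> stays in \<open>D(A)\<close>, and the right derivative of \<open>\<parallel>P (S t x)\<parallel>\<^sup>2\<close> is
  \<open>2 Re \<langle>P A (S t x), P (S t x)\<rangle> = 2 Re \<langle>P A (S t x), S t x\<rangle> \<le> 0\<close>, because an orthogonal projection
  satisfies \<open>\<langle>P y, z\<rangle> = \<langle>P y, P z\<rangle>\<close>. As \<open>D(A)\<close> is dense, \<open>\<parallel>P (S t x)\<parallel> \<le> \<parallel>P x\<parallel>\<close> holds for all \<open>x\<close>
  (\<open>orbit_seminorm_decreasing\<close>). From there on the generator is no longer mentioned.

  Let \<open>f = P u\<close> and let \<open>x\<close> be the mild solution with input \<open>f\<close>. Then \<open>x(t + h) = S h (x(t)) + w\<^sub>h\<close>,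
  where \<open>w\<^sub>h = \<integral>\<^sub>t\<^sup>t\<^sup>+\<^sup>h S (t + h - s) f(s) ds = h f(t) + o(h)\<close>. Expanding the square in
  \<open>\<parallel>P (x(t + h) - w\<^sub>h)\<parallel>\<^sup>2 \<le> \<parallel>P x(t)\<parallel>\<^sup>2\<close> bounds the upper right Dini derivative of \<open>\<parallel>P x(t)\<parallel>\<^sup>2\<close> by
  \<open>2 Re \<langle>P x(t), P f(t)\<rangle>\<close>. Integration gives the energy inequality
  \<open>\<parallel>P x(T)\<parallel>\<^sup>2 \<le> 2 \<integral>\<^sub>0\<^sup>T Re \<langle>P x(t), P f(t)\<rangle> dt\<close> (\<open>energy_inequality\<close>), whose right-hand side is twice
  the work since \<open>P f = f\<close> and \<open>P\<close> is self-adjoint.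

  Both steps differentiate from the right only, so a single monotonicity principle,
  \<open>le_if_right_quotients_nonpos\<close>, serves both. Since \<open>x(t)\<close> may fail to lie in \<open>D(A)\<close>, arguing by
  \<open>x' = A x + f\<close> would need an approximation of \<open>u\<close> by smooth inputs; the difference quotients above
  make this unnecessary.
\<close>

section \<open>One-sided calculus\<close>

text \<open>
  A continuous function whose upper right Dini derivative is nowhere positive is nonincreasing. For a
  slope \<open>e > 0\<close> the largest point \<open>c\<close> where \<open>\<phi> c \<le> \<phi> a + e * (c - a)\<close> must be \<open>b\<close>, as the bound on
  the quotients would otherwise push it to the right. The quotients are only required to have a
  convergent majorant \<open>g\<close>, because the energy estimate for mild solutions provides no more than that.
\<close>

lemma le_if_right_quotients_nonpos:
  fixes \<phi> :: "real \<Rightarrow> real"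
  assumes "a \<le> b" and cont: "continuous_on {a..b} \<phi>"
    and quot: "\<And>t. a \<le> t \<Longrightarrow> t < b \<Longrightarrow>
      \<exists>g L. (g \<longlongrightarrow> L) (at_right 0) \<and> L \<le> 0 \<and>
        (\<forall>\<^sub>F h in at_right 0. \<phi> (t + h) - \<phi> t \<le> h * g h)"
  shows "\<phi> b \<le> \<phi> a"
proof (rule field_le_epsilon)
  fix d :: real assume "0 < d"
  (* the summand 1 keeps the denominator positive when a = b *)
  define e where "e = d / (b - a + 1)"
  have e: "0 < e" "e * (b - a) \<le> d"
    using \<open>0 < d\<close> \<open>a \<le> b\<close> by (auto simp: e_def field_simps)
  define K where "K = {a..b} \<inter> (\<lambda>t. \<phi> t - e * (t - a)) -` {..\<phi> a}"
  have "closed K"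
    unfolding K_def by (intro continuous_closed_preimage continuous_intros cont)
  moreover have "bounded K"
    by (rule bounded_subset[of "{a..b}"]) (auto simp: K_def)
  ultimately have "compact K" by (simp add: compact_eq_bounded_closed)
  moreover have "a \<in> K" using \<open>a \<le> b\<close> by (simp add: K_def)
  ultimately obtain c where c: "c \<in> K" "\<And>t. t \<in> K \<Longrightarrow> t \<le> c"
    by (metis compact_attains_sup empty_iff)
  have "c = b"
  proof (rule ccontr)
    assume "c \<noteq> b"
    with c(1) have cb: "a \<le> c" "c < b" by (auto simp: K_def)
    from quot[OF cb] obtain g L where g: "(g \<longlongrightarrow> L) (at_right 0)" "L \<le> 0"
      and step: "\<forall>\<^sub>F h in at_right 0. \<phi> (c + h) - \<phi> c \<le> h * g h" by blast
    have "\<forall>\<^sub>F h in at_right 0. g h < e"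
      using order_tendstoD(2)[OF g(1), of e] g(2) e(1) by simp
    moreover have "\<forall>\<^sub>F h in at_right 0. h < b - c"
      using cb by (intro order_tendstoD(2)[OF tendsto_ident_at]) simp
    moreover have "\<forall>\<^sub>F h :: real in at_right 0. 0 < h"
      by (rule eventually_at_right_less)
    ultimately have "\<forall>\<^sub>F h in at_right 0. 0 < h \<and> c + h \<in> K"
      using step
    proof eventually_elim
      case (elim h)
      from elim have "h * g h \<le> h * e" by (intro mult_left_mono) auto
      with elim(4) have "\<phi> (c + h) \<le> \<phi> c + h * e" by linarith
      with elim cb c(1) show ?case by (auto simp: K_def algebra_simps)
    qed
    from eventually_happens[OF this] obtain h where "0 < h" "c + h \<in> K"
      using trivial_limit_at_right_real by blast
    with c(2)[of "c + h"] show False by simp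
  qed
  with c(1) e(2) show "\<phi> b \<le> \<phi> a + d" by (auto simp: K_def)
qed

text \<open>
  The integrand \<open>F h\<close> may change with the length of the interval: the increment of a mild solution
  over \<open>[t, t + h]\<close> integrates \<open>S (t + h - s) (f s)\<close>.
\<close>

lemma averages_tendsto:
  fixes F :: "real \<Rightarrow> real \<Rightarrow> 'b::banach"
  assumes close: "\<And>e. 0 < e \<Longrightarrow> \<forall>\<^sub>F h in at_right 0.
      continuous_on {t..t + h} (F h) \<and> (\<forall>s\<in>{t..t + h}. norm (F h s - c) \<le> e)"
  shows "((\<lambda>h. integral {t..t + h} (F h) /\<^sub>R h) \<longlongrightarrow> c) (at_right 0)"
proof (rule tendstoI)
  fix e :: real assume "0 < e"
  then have "0 < e / 2" by simp
  from close[OF this] eventually_at_right_less[of 0]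
  show "\<forall>\<^sub>F h in at_right 0. dist (integral {t..t + h} (F h) /\<^sub>R h) c < e"
  proof eventually_elim
    case (elim h)
    then have cont: "continuous_on {t..t + h} (F h)" and "0 < h" by auto
    have "integral {t..t + h} (F h) - h *\<^sub>R c = integral {t..t + h} (\<lambda>s. F h s - c)"
      using \<open>0 < h\<close> by (subst Henstock_Kurzweil_Integration.integral_diff) (auto intro: integrable_continuous_real cont)
    moreover have "norm (integral {t..t + h} (\<lambda>s. F h s - c)) \<le> e / 2 * (t + h - t)"
      using elim \<open>0 < h\<close> by (intro integral_bound continuous_intros cont) auto
    ultimately have "norm (integral {t..t + h} (F h) - h *\<^sub>R c) \<le> e / 2 * h" by simp
    moreover have "integral {t..t + h} (F h) /\<^sub>R h - c
        = (integral {t..t + h} (F h) - h *\<^sub>R c) /\<^sub>R h"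
      using \<open>0 < h\<close> by (simp add: algebra_simps)
    ultimately have "dist (integral {t..t + h} (F h) /\<^sub>R h) c \<le> e / 2"
      using \<open>0 < h\<close> by (simp add: dist_norm divide_simps mult.commute)
    also have "\<dots> < e" using \<open>0 < e\<close> by simp
    finally show ?case .
  qed
qed

lemma integral_right_quotient_tendsto:
  fixes f :: "real \<Rightarrow> 'b::banach"
  assumes cont: "continuous_on {a..b} f" and t: "a \<le> t" "t < b"
  shows "((\<lambda>h. (integral {a..t + h} f - integral {a..t} f) /\<^sub>R h) \<longlongrightarrow> f t) (at_right 0)"
proof -
  have "((\<lambda>h. integral {t..t + h} f /\<^sub>R h) \<longlongrightarrow> f t) (at_right 0)"
  proof (rule averages_tendsto)
    fix e :: real assume "0 < e"
    then obtain d where d: "0 < d"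
      "\<And>s. s \<in> {a..b} \<Longrightarrow> dist s t < d \<Longrightarrow> dist (f s) (f t) < e"
      using cont t unfolding continuous_on_iff by (metis atLeastAtMost_iff less_imp_le)
    have "\<forall>\<^sub>F h in at_right 0. h < min d (b - t)"
      using d(1) t by (intro order_tendstoD(2)[OF tendsto_ident_at]) simp
    then show "\<forall>\<^sub>F h in at_right 0.
        continuous_on {t..t + h} f \<and> (\<forall>s\<in>{t..t + h}. norm (f s - f t) \<le> e)"
    proof eventually_elim
      case (elim h)
      have "norm (f s - f t) \<le> e" if "s \<in> {t..t + h}" for s
        using d(2)[of s] that elim t by (auto simp: dist_norm)
      moreover have "continuous_on {t..t + h} f"
        using elim t by (intro continuous_on_subset[OF cont]) auto
      ultimately show ?case by blast
    qed
  qed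
  moreover have "\<forall>\<^sub>F h in at_right 0. h < b - t"
    using t by (intro order_tendstoD(2)[OF tendsto_ident_at]) simp
  then have "\<forall>\<^sub>F h in at_right 0.
      integral {t..t + h} f /\<^sub>R h = (integral {a..t + h} f - integral {a..t} f) /\<^sub>R h"
    using eventually_at_right_less[of 0]
  proof eventually_elim
    case (elim h)
    then have "integral {a..t} f + integral {t..t + h} f = integral {a..t + h} f"
      using t by (intro Henstock_Kurzweil_Integration.integral_combine integrable_continuous_real
          continuous_on_subset[OF cont]) auto
    then have "integral {a..t + h} f - integral {a..t} f = integral {t..t + h} f"
      by (simp add: algebra_simps)
    then show ?case by simp
  qed
  ultimately show ?thesis by (rule Lim_transform_eventually)
qed

section \<open>Strongly continuous semigroups\<close>

text \<open>
  The Banach-Steinhaus theorem. By Baire's theorem one of the closed sets of points at which the family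
  is bounded by \<open>n\<close> contains a ball, and translating that ball to the origin bounds the operators.
\<close>

lemma uniform_boundedness:
  fixes F :: "'i \<Rightarrow> 'a::banach \<Rightarrow> 'b::real_normed_vector"
  assumes lin: "\<And>i. i \<in> I \<Longrightarrow> bounded_linear (F i)"
    and ptw: "\<And>x. bounded ((\<lambda>i. F i x) ` I)"
  shows "\<exists>M. \<forall>i\<in>I. \<forall>x. norm (F i x) \<le> M * norm x"
proof -
  define G where "G n = {x. \<forall>i\<in>I. norm (F i x) \<le> real n}" for n
  have "closed (G n)" for n
  proof -
    have "G n = (\<Inter>i\<in>I. {x. norm (F i x) \<le> real n})" by (auto simp: G_def)
    then show ?thesis
      by (auto intro!: closed_INT closed_Collect_le continuous_intros
          bounded_linear.continuous_on[OF lin])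
  qed
  have "x \<in> \<Union> (range G)" for x
  proof -
    from ptw[of x] obtain C where C: "\<forall>i\<in>I. norm (F i x) \<le> C" by (auto simp: bounded_iff)
    obtain n where "C \<le> real n" using real_arch_simple by blast
    with C have "x \<in> G n" by (force simp: G_def)
    then show ?thesis by blast
  qed
  then have "\<Union> (range G) = UNIV" by blast
  have "\<exists>n. interior (G n) \<noteq> {}"
  proof (rule ccontr)
    assume "\<not> ?thesis"
    then have "Met_TC.mtopology interior_of \<Union> (range G) = {}"
      using \<open>\<And>n. closed (G n)\<close>
      by (intro Met_TC.metric_Baire_category_alt) (auto simp: complete_UNIV)
    then show False by (simp add: \<open>\<Union> (range G) = UNIV\<close>)
  qed
  then obtain n x r where r: "0 < r" "cball x r \<subseteq> G n"
    by (metis equals0I mem_interior_cball)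
  have "norm (F i y) \<le> 2 * n / r * norm y" if "i \<in> I" for i y
  proof (cases "y = 0")
    case False
    interpret bounded_linear "F i" by (rule lin[OF that])
    define z where "z = (r / norm y) *\<^sub>R y"
    have "norm z = r" using False r(1) by (simp add: z_def)
    then have "x + z \<in> G n" "x \<in> G n" using r by (auto simp: dist_norm)
    then have "norm (F i (x + z) - F i x) \<le> 2 * n"
      using that norm_triangle_ineq4[of "F i (x + z)" "F i x"] by (force simp: G_def)
    then have "r / norm y * norm (F i y) \<le> 2 * n"
      using False r(1) by (simp add: add z_def scaleR)
    then show ?thesis using False r(1) by (simp add: field_simps)
  qed (use linear_0[OF bounded_linear.linear[OF lin[OF that]]] in simp)
  then show ?thesis by blast
qed

text \<open>
  The operators are taken to be real-linear; complex scalars enter only through the inner product.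
\<close>

locale strongly_continuous_semigroup =
  fixes S :: "real \<Rightarrow> 'h::banach \<Rightarrow> 'h"
  assumes linear: "0 \<le> t \<Longrightarrow> bounded_linear (S t)"
    and at_0: "S 0 x = x"
    and orbit_add: "0 \<le> s \<Longrightarrow> 0 \<le> t \<Longrightarrow> S (s + t) x = S s (S t x)"
    and right_continuous_0: "((\<lambda>t. S t x) \<longlongrightarrow> x) (at_right 0)"
begin

text \<open>
  If the bound failed on every interval, there would be times \<open>\<tau> n \<rightarrow> 0\<close> with operator norms exceeding
  \<open>n\<close>; but each orbit converges along \<open>\<tau>\<close>, so this contradicts uniform boundedness.
\<close>

lemma bounded_near_0:
  "\<exists>d>0. \<exists>M\<ge>1. \<forall>t\<in>{0..d}. \<forall>x. norm (S t x) \<le> M * norm x"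
proof (rule ccontr)
  assume neg: "\<not> ?thesis"
  have "\<exists>t\<in>{0..1 / (real n + 1)}. \<exists>x. \<not> norm (S t x) \<le> (real n + 1) * norm x" for n
    using neg by (metis add_nonneg_pos divide_pos_pos le_add_same_cancel2 of_nat_0_le_iff zero_less_one)
  then obtain \<tau> where \<tau>: "\<And>n. \<tau> n \<in> {0..1 / (real n + 1)}"
    and big: "\<And>n. \<exists>x. \<not> norm (S (\<tau> n) x) \<le> (real n + 1) * norm x"
    by metis
  have "\<tau> n \<noteq> 0" for n
  proof
    assume "\<tau> n = 0"
    with big[of n] have "\<exists>x. \<not> norm (x :: 'h) \<le> (real n + 1) * norm x" by (simp add: at_0)
    then obtain x where "\<not> norm (x :: 'h) \<le> (real n + 1) * norm x" ..
    then show False by (simp add: algebra_simps)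
  qed
  then have pos: "0 < \<tau> n" for n using \<tau>[of n] by (simp add: order_less_le)
  have "\<tau> \<longlonglongrightarrow> 0"
  proof (rule tendsto_sandwich[of "\<lambda>_. 0"])
    show "(\<lambda>n. 1 / (real n + 1)) \<longlonglongrightarrow> 0"
      using LIMSEQ_inverse_real_of_nat by (simp add: inverse_eq_divide add.commute)
  qed (use \<tau> in auto)
  then have "filterlim \<tau> (at_right 0) sequentially"
    using pos by (auto simp: filterlim_at less_imp_neq[OF pos, symmetric])
  from filterlim_compose[OF right_continuous_0 this]
  have "bounded (range (\<lambda>n. S (\<tau> n) x))" for x
    by (rule convergent_imp_bounded)
  moreover have "bounded_linear (S (\<tau> n))" for n by (rule linear) (simp add: less_imp_le pos)
  ultimately have "\<exists>M. \<forall>n\<in>UNIV. \<forall>x. norm (S (\<tau> n) x) \<le> M * norm x"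
    by (intro uniform_boundedness)
  then obtain M where M: "\<And>n x. norm (S (\<tau> n) x) \<le> M * norm x" by blast
  obtain n where "M \<le> real n" using real_arch_simple by blast
  then have "M * norm x \<le> (real n + 1) * norm x" for x :: 'h
    by (intro mult_right_mono) auto
  with M big[of n] show False by (meson order_trans)
qed

lemma bounded_on_Icc:
  obtains M where "1 \<le> M" "\<And>t x. 0 \<le> t \<Longrightarrow> t \<le> b \<Longrightarrow> norm (S t x) \<le> M * norm x"
proof -
  from bounded_near_0 obtain d M where d: "0 < d" and M: "1 \<le> M"
    and near: "\<And>t x. 0 \<le> t \<Longrightarrow> t \<le> d \<Longrightarrow> norm (S t x) \<le> M * norm x"
    by force
  have *: "norm (S t x) \<le> M ^ Suc n * norm x" if "0 \<le> t" "t \<le> real (Suc n) * d" for n t x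
    using that
  proof (induction n arbitrary: t)
    case (Suc n)
    show ?case
    proof (cases "t \<le> d")
      case True
      have "M * norm x \<le> M ^ Suc (Suc n) * norm x"
        using M by (intro mult_right_mono self_le_power) auto
      with near[of t x] True Suc.prems show ?thesis by linarith
    next
      case False
      then have "norm (S t x) = norm (S d (S (t - d) x))"
        using orbit_add[of d "t - d" x] d by simp
      also have "\<dots> \<le> M * norm (S (t - d) x)" using near d by simp
      also have "\<dots> \<le> M * (M ^ Suc n * norm x)"
        using Suc.prems False M by (intro mult_left_mono Suc.IH) (auto simp: algebra_simps)
      finally show ?thesis by (simp add: mult.assoc)
    qed
  qed (use near in auto)
  obtain n where "b / d \<le> real n" using real_arch_simple by blast
  then have "b \<le> real (Suc n) * d" using d by (simp add: field_simps)
  with * have "norm (S t x) \<le> M ^ Suc n * norm x" if "0 \<le> t" "t \<le> b" for t x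
    using that by force
  moreover have "1 \<le> M ^ Suc n" using M by (rule one_le_power)
  ultimately show ?thesis using that by blast
qed

text \<open>
  Joint continuity is what makes the integrands of mild solutions continuous. It follows from
  \<open>S s w - S t v = S s (w - v) + (S s v - S t v)\<close> and local boundedness. The second term is compared
  with \<open>S \<bar>s - t\<bar> v - v\<close> by pulling out the operator at the earlier of the two times, which turns
  right continuity at \<open>0\<close> into two-sided continuity everywhere.
\<close>

lemma continuous_on_pair: "continuous_on ({0..} \<times> UNIV) (\<lambda>(t, v). S t v)"
  unfolding continuous_on_def
proof (clarsimp)
  fix t v assume "0 \<le> (t::real)"
  obtain M where M: "1 \<le> M" "\<And>r x. 0 \<le> r \<Longrightarrow> r \<le> t + 1 \<Longrightarrow> norm (S r x) \<le> M * norm x"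
    using bounded_on_Icc[of "t + 1"] by blast
  have orbit: "norm (S s v - S t v) \<le> M * norm (S \<bar>s - t\<bar> v - v)"
    if s: "0 \<le> s" "s \<le> t + 1" for s
  proof -
    have "norm (S q v - S p v) \<le> M * norm (S (q - p) v - v)"
      if "0 \<le> p" "p \<le> q" "p \<le> t + 1" for p q
    proof -
      interpret bounded_linear "S p" using that(1) by (rule linear)
      have "S q v - S p v = S p (S (q - p) v - v)"
        using orbit_add[of p "q - p" v] that by (simp add: diff)
      then show ?thesis using M that by simp
    qed
    from this[of s t] this[of t s] s \<open>0 \<le> t\<close> show ?thesis
      by (cases "s \<le> t") (auto simp: norm_minus_commute abs_real_def)
  qed
  have "filterlim (\<lambda>r::real. \<bar>r\<bar>) (at_right 0) (at 0)"
    by (auto simp: filterlim_at eventually_at_filter intro!: tendsto_eq_intros)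
  from filterlim_compose[OF right_continuous_0 this]
  have "((\<lambda>r. S \<bar>r\<bar> v) \<longlongrightarrow> v) (at 0)" .
  then have "isCont (\<lambda>r. S \<bar>r\<bar> v) 0" by (simp add: isCont_def at_0)
  then have *: "((\<lambda>p. S \<bar>g p\<bar> v) \<longlongrightarrow> v) F" if "(g \<longlongrightarrow> 0) F"
    for F and g :: "real \<times> 'h \<Rightarrow> real"
    using isCont_tendsto_compose[OF _ that, of "\<lambda>r. S \<bar>r\<bar> v"] by (simp add: at_0)
  let ?F = "at (t, v) within {0..} \<times> UNIV"
  have lim: "((\<lambda>p. fst p) \<longlongrightarrow> t) ?F" "((\<lambda>p. snd p) \<longlongrightarrow> v) ?F"
    using tendsto_fst[OF tendsto_ident_at] tendsto_snd[OF tendsto_ident_at] by fastforce+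
  have "((\<lambda>p. S \<bar>fst p - t\<bar> v) \<longlongrightarrow> v) ?F"
    by (rule *) (use tendsto_diff[OF lim(1) tendsto_const[of t]] in simp)
  then have majorant: "((\<lambda>p. M * norm (snd p - v) + M * norm (S \<bar>fst p - t\<bar> v - v))
      \<longlongrightarrow> M * norm (v - v) + M * norm (v - v)) ?F"
    by (intro tendsto_intros lim)
  have nonneg: "\<forall>\<^sub>F p in ?F. 0 \<le> fst p"
    by (auto simp: eventually_at_filter intro!: always_eventually)
  have "\<forall>\<^sub>F p in ?F. fst p < t + 1"
    using lim(1) by (rule order_tendstoD) simp
  then have "\<forall>\<^sub>F p in ?F. norm ((\<lambda>(s, w). S s w) p - S t v)
      \<le> M * norm (snd p - v) + M * norm (S \<bar>fst p - t\<bar> v - v)"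
    using nonneg
  proof eventually_elim
    case (elim p)
    then have "fst p < t + 1" "0 \<le> fst p" .
    interpret bounded_linear "S (fst p)" using \<open>0 \<le> fst p\<close> by (rule linear)
    have "(\<lambda>(s, w). S s w) p - S t v = S (fst p) (snd p - v) + (S (fst p) v - S t v)"
      by (simp add: case_prod_beta diff)
    also have "norm \<dots> \<le> norm (S (fst p) (snd p - v)) + norm (S (fst p) v - S t v)"
      by (rule norm_triangle_ineq)
    finally show ?case
      using M(2)[of "fst p" "snd p - v"] orbit[of "fst p"] \<open>fst p < t + 1\<close> \<open>0 \<le> fst p\<close> by linarith
  qed
  then have "((\<lambda>p. (\<lambda>(s, w). S s w) p - S t v) \<longlongrightarrow> 0) ?F"
    by (rule Lim_null_comparison) (use majorant in simp)
  then show "((\<lambda>(s, w). S s w) \<longlongrightarrow> S t v) ?F" by (simp add: LIM_zero_iff)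
qed

lemma continuous_on_apply:
  assumes "continuous_on X f" "continuous_on X g" "\<And>x. x \<in> X \<Longrightarrow> 0 \<le> f x"
  shows "continuous_on X (\<lambda>x. S (f x) (g x))"
  using continuous_on_compose2[OF continuous_on_pair continuous_on_Pair[OF assms(1,2)]] assms(3)
  by auto

lemma orbit_continuous: "continuous_on X (\<lambda>t. S t x)" if "X \<subseteq> {0..}"
  using that by (intro continuous_on_apply continuous_intros) auto

lemma generator_orbit:
  assumes "generator S x = Some y" "0 \<le> t"
  shows "generator S (S t x) = Some (S t y)"
proof -
  interpret bounded_linear "S t" using \<open>0 \<le> t\<close> by (rule linear)
  have "((\<lambda>h. S t ((S h x - x) /\<^sub>R h)) \<longlongrightarrow> S t y) (at_right 0)"
    using assms(1) by (intro tendsto) (simp add: generator_eq_Some_iff)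
  moreover have "\<forall>\<^sub>F h in at_right 0. S t ((S h x - x) /\<^sub>R h) = (S h (S t x) - S t x) /\<^sub>R h"
    using eventually_at_right_less[of 0]
  proof eventually_elim
    case (elim h)
    then have "S t (S h x) = S h (S t x)"
      using orbit_add[of t h x] orbit_add[of h t x] \<open>0 \<le> t\<close> by (simp add: add.commute)
    then show ?case by (simp add: scaleR diff)
  qed
  ultimately show ?thesis
    unfolding generator_eq_Some_iff by (rule Lim_transform_eventually)
qed

text \<open>
  Integrals of orbits lie in the domain even when the orbit itself does not: shifting the integral
  by \<open>h\<close> changes it only near its end points.
\<close>

lemma generator_integral_orbit:
  assumes "0 \<le> b"
  shows "generator S (integral {0..b} (\<lambda>r. S r x)) = Some (S b x - x)"
proof -
  let ?J = "\<lambda>t. integral {0..t} (\<lambda>r. S r x)"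
  have cont: "continuous_on {0..c} (\<lambda>r. S r x)" for c by (rule orbit_continuous) auto
  have shift: "S h (?J b) = ?J (b + h) - ?J h" if "0 \<le> h" for h
  proof -
    have "S h (?J b) = integral {0..b} (\<lambda>r. S h (S r x))"
      using integral_linear[OF integrable_continuous_real[OF cont] linear[OF that]]
      by (simp add: o_def)
    also have "\<dots> = integral {0..b} (\<lambda>r. S (r + h) x)"
      using that by (intro integral_cong) (simp add: add.commute flip: orbit_add)
    also have "\<dots> = integral {h..b + h} (\<lambda>r. S r x)"
      using integral_shift_real_ivl[of h h "b + h" "\<lambda>r. S r x"] by simp
    also have "\<dots> = ?J (b + h) - ?J h"
      using Henstock_Kurzweil_Integration.integral_combine
          [OF _ _ integrable_continuous_real[OF cont], of h "b + h"] that assms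
      by (simp add: algebra_simps)
    finally show ?thesis .
  qed
  have "((\<lambda>h. (?J (b + h) - ?J b) /\<^sub>R h - (?J (0 + h) - ?J 0) /\<^sub>R h) \<longlongrightarrow> S b x - S 0 x) (at_right 0)"
    using assms by (intro tendsto_diff integral_right_quotient_tendsto[of _ "b + 1"] cont) auto
  moreover have "\<forall>\<^sub>F h in at_right 0.
      (?J (b + h) - ?J b) /\<^sub>R h - (?J (0 + h) - ?J 0) /\<^sub>R h = (S h (?J b) - ?J b) /\<^sub>R h"
    using eventually_at_right_less[of 0]
    by eventually_elim (simp add: shift algebra_simps)
  ultimately show ?thesis
    unfolding generator_eq_Some_iff by (simp add: at_0 Lim_transform_eventually)
qed

lemma generator_scaleR:
  assumes "generator S x = Some y"
  shows "generator S (c *\<^sub>R x) = Some (c *\<^sub>R y)"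
proof -
  have "((\<lambda>h. c *\<^sub>R ((S h x - x) /\<^sub>R h)) \<longlongrightarrow> c *\<^sub>R y) (at_right 0)"
    using assms by (intro tendsto_intros) (simp add: generator_eq_Some_iff)
  moreover have "\<forall>\<^sub>F h in at_right 0.
      c *\<^sub>R ((S h x - x) /\<^sub>R h) = (S h (c *\<^sub>R x) - c *\<^sub>R x) /\<^sub>R h"
    using eventually_at_right_less[of 0]
  proof eventually_elim
    case (elim h)
    then show ?case
      using bounded_linear.linear[OF linear, of h] by (simp add: linear_scale algebra_simps)
  qed
  ultimately show ?thesis
    unfolding generator_eq_Some_iff by (rule Lim_transform_eventually)
qed

text \<open>The averages of the orbit over \<open>[0, h]\<close> lie in the domain and converge to its starting point.\<close>

lemma generator_dense: "x \<in> closure (dom (generator S))"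
proof -
  let ?a = "\<lambda>h. integral {0..h} (\<lambda>r. S r x) /\<^sub>R h"
  have "(?a \<longlongrightarrow> S 0 x) (at_right 0)"
    using integral_right_quotient_tendsto[OF orbit_continuous, of 0 1 0 x] by simp
  moreover have "\<forall>\<^sub>F h in at_right 0. ?a h \<in> closure (dom (generator S))"
    using eventually_at_right_less[of 0]
  proof eventually_elim
    case (elim h)
    then show ?case
      using generator_scaleR[OF generator_integral_orbit, of h]
      by (intro subsetD[OF closure_subset]) (auto simp: dom_def)
  qed
  ultimately show ?thesis
    using Lim_in_closed_set[OF closed_closure _ trivial_limit_at_right_real] by (simp add: at_0)
qed

section \<open>Mild solutions\<close>

text \<open>The mild solution with zero initial value for the inhomogeneity \<open>f\<close>, which stands for \<open>P u\<close>.\<close>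

definition duhamel :: "(real \<Rightarrow> 'h) \<Rightarrow> real \<Rightarrow> 'h"
  where "duhamel f t = integral {0..t} (\<lambda>s. S (t - s) (f s))"

text \<open>
  Both the upper limit and the integrand depend on \<open>t\<close>. Extending the integrand by \<open>S 0 (f s) = f s\<close>
  to \<open>s \<ge> t\<close> keeps it jointly continuous and makes the domain \<open>[0, T]\<close> fixed, at the price of the
  extra term \<open>\<integral>\<^sub>t\<^sup>T f\<close>, which is continuous in \<open>t\<close> as well.
\<close>

lemma duhamel_continuous:
  assumes f: "continuous_on {0..T} f"
  shows "continuous_on {0..T} (duhamel f)"
proof -
  let ?G = "\<lambda>t. integral (cbox 0 T) (\<lambda>s. S (max 0 (t - s)) (f s))"
  have "continuous_on ({0..T} \<times> cbox 0 T) (\<lambda>(t, s). S (max 0 (t - s)) (f s))"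
    unfolding case_prod_beta
    by (intro continuous_on_apply continuous_intros continuous_on_compose2[OF f]) auto
  then have "continuous_on {0..T} ?G" by (rule integral_continuous_on_param)
  then have "continuous_on {0..T} (\<lambda>t. ?G t - (integral {0..T} f - integral {0..t} f))"
    by (intro continuous_intros indefinite_integral_continuous_1 integrable_continuous_real f)
  moreover have "?G t - (integral {0..T} f - integral {0..t} f) = duhamel f t"
    if t: "t \<in> {0..T}" for t
  proof -
    have cont: "continuous_on {0..T} (\<lambda>s. S (max 0 (t - s)) (f s))"
      by (intro continuous_on_apply continuous_intros f) auto
    have "?G t = integral {0..t} (\<lambda>s. S (max 0 (t - s)) (f s))
        + integral {t..T} (\<lambda>s. S (max 0 (t - s)) (f s))"
      using t Henstock_Kurzweil_Integration.integral_combine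
          [OF _ _ integrable_continuous_real[OF cont], of t] by simp
    also have "integral {0..t} (\<lambda>s. S (max 0 (t - s)) (f s)) = duhamel f t"
      unfolding duhamel_def by (rule integral_cong) simp
    also have "integral {t..T} (\<lambda>s. S (max 0 (t - s)) (f s)) = integral {t..T} f"
      by (rule integral_cong) (auto simp: at_0 max_def)
    also have "integral {t..T} f = integral {0..T} f - integral {0..t} f"
      using t Henstock_Kurzweil_Integration.integral_combine
          [OF _ _ integrable_continuous_real[OF f], of t] by (simp add: algebra_simps)
    finally show ?thesis by simp
  qed
  ultimately show ?thesis using continuous_on_eq by blast
qed

lemma duhamel_add:
  assumes f: "continuous_on {0..T} f" and "0 \<le> t" "0 \<le> h" "t + h \<le> T"
  shows "duhamel f (t + h) = S h (duhamel f t) + integral {t..t + h} (\<lambda>s. S (t + h - s) (f s))"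
proof -
  have cont: "continuous_on {0..r} (\<lambda>s. S (r - s) (f s))" if "r \<le> T" for r
    using that by (intro continuous_on_apply continuous_intros continuous_on_subset[OF f]) auto
  have "S h (duhamel f t) = integral {0..t} (\<lambda>s. S h (S (t - s) (f s)))"
    using integral_linear[OF integrable_continuous_real[OF cont] linear, of t h] assms
    by (simp add: o_def duhamel_def)
  also have "\<dots> = integral {0..t} (\<lambda>s. S (t + h - s) (f s))"
    using \<open>0 \<le> h\<close> by (intro integral_cong) (simp add: algebra_simps flip: orbit_add)
  also have "\<dots> + integral {t..t + h} (\<lambda>s. S (t + h - s) (f s)) = duhamel f (t + h)"
    unfolding duhamel_def using assms
    by (intro Henstock_Kurzweil_Integration.integral_combine integrable_continuous_real cont) auto
  finally show ?thesis by simp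
qed

lemma duhamel_increment_tendsto:
  assumes f: "continuous_on {0..T} f" and t: "0 \<le> t" "t < T"
  shows "((\<lambda>h. integral {t..t + h} (\<lambda>s. S (t + h - s) (f s)) /\<^sub>R h) \<longlongrightarrow> f t) (at_right 0)"
proof (rule averages_tendsto)
  fix e :: real assume "0 < e"
  have "continuous_on ({0..T} \<times> {0..}) (\<lambda>p. S (snd p) (f (fst p)))"
    by (intro continuous_on_apply continuous_intros continuous_on_compose2[OF f]) auto
  moreover have "(t, 0::real) \<in> {0..T} \<times> {0..}" using t by simp
  ultimately obtain d where d: "0 < d" "\<And>p. p \<in> {0..T} \<times> {0..} \<Longrightarrow> dist p (t, 0) < d \<Longrightarrow>
      dist (S (snd p) (f (fst p))) (S (snd (t, 0::real)) (f (fst (t, 0::real)))) < e"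
    using \<open>0 < e\<close> unfolding continuous_on_iff by blast
  have "\<forall>\<^sub>F h in at_right 0. h < min d (T - t)"
    using d(1) t by (intro order_tendstoD(2)[OF tendsto_ident_at]) simp
  then show "\<forall>\<^sub>F h in at_right 0. continuous_on {t..t + h} (\<lambda>s. S (t + h - s) (f s)) \<and>
      (\<forall>s\<in>{t..t + h}. norm (S (t + h - s) (f s) - f t) \<le> e)"
  proof eventually_elim
    case (elim h)
    have "norm (S (t + h - s) (f s) - f t) \<le> e" if "s \<in> {t..t + h}" for s
    proof -
      have "dist (s, t + h - s) (t, 0) \<le> \<bar>s - t\<bar> + \<bar>t + h - s\<bar>"
        by (simp add: dist_Pair_Pair dist_real_def sqrt_sum_squares_le_sum_abs)
      also have "\<dots> < d" using that elim by simp
      finally show ?thesis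
        using d(2)[of "(s, t + h - s)"] that elim t by (simp add: at_0 dist_norm)
    qed
    moreover have "continuous_on {t..t + h} (\<lambda>s. S (t + h - s) (f s))"
      using elim t by (intro continuous_on_apply continuous_intros continuous_on_subset[OF f]) auto
    ultimately show ?case by blast
  qed
qed

end

section \<open>The inner product\<close>

lemma bounded_linear_to_complex: "bounded_linear (to_complex :: 'k::real_or_complex \<Rightarrow> complex)"
  by (rule bounded_linear_intro[where K = 1])
    (simp_all add: to_complex_add to_complex_scaleR norm_to_complex)

text \<open>The image of \<open>1\<close> is an idempotent of norm \<open>1\<close>, hence equal to \<open>1\<close>.\<close>

lemma to_complex_of_real: "to_complex (of_real r :: 'k::real_or_complex) = of_real r"
proof -
  let ?z = "to_complex (1 :: 'k)"
  have "norm ?z = 1" by (simp add: norm_to_complex)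
  moreover have "?z * ?z = ?z" by (simp flip: to_complex_mult)
  ultimately have "?z = 1" by auto
  then show ?thesis by (simp add: of_real_def to_complex_scaleR)
qed

lemma inj_to_complex: "inj (to_complex :: 'k::real_or_complex \<Rightarrow> complex)"
proof (rule injI)
  fix a b :: 'k assume "to_complex a = to_complex b"
  then have "to_complex (a - b) = 0"
    by (simp add: linear_diff[OF bounded_linear.linear[OF bounded_linear_to_complex]])
  then show "a = b" using norm_to_complex[of "a - b"] by simp
qed

context hilbert_space
begin

lemma ip_add_right: "ip x (y + z) = ip x y + ip x z"
  by (rule injD[OF inj_to_complex])
    (simp add: ip_commute[of x] ip_add_left to_complex_add)

lemma ip_scaleR_left: "ip (r *\<^sub>R x) y = r *\<^sub>R ip x y"
  by (simp add: ip_scale_left scaleR_conv_of_real flip: scale_of_real)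

lemma ip_scaleR_right: "ip x (r *\<^sub>R y) = r *\<^sub>R ip x y"
  by (rule injD[OF inj_to_complex])
    (simp add: ip_commute[of x] ip_scaleR_left to_complex_scaleR)

text \<open>
  The real inner product of the underlying real Hilbert space. The energy estimates are
  stated in terms of it; bounds for \<open>ip\<close> itself serve to take the real part out of the integral that
  defines the work.
\<close>

definition re_ip :: "'h \<Rightarrow> 'h \<Rightarrow> real"
  where "re_ip x y = Re (to_complex (ip x y))"

lemma re_ip_commute: "re_ip x y = re_ip y x"
  by (simp add: re_ip_def ip_commute[of x y])

lemma to_complex_ip_same: "to_complex (ip x x) = of_real ((norm x)\<^sup>2)"
  by (simp only: norm_sq to_complex_of_real)

lemma re_ip_same: "re_ip x x = (norm x)\<^sup>2"
  by (simp add: re_ip_def to_complex_ip_same del: of_real_power)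

lemma re_ip_simps:
  "re_ip (x + y) z = re_ip x z + re_ip y z" "re_ip z (x + y) = re_ip z x + re_ip z y"
  "re_ip (r *\<^sub>R x) z = r * re_ip x z" "re_ip z (r *\<^sub>R x) = r * re_ip z x"
  by (simp_all add: re_ip_def ip_add_left ip_add_right ip_scaleR_left ip_scaleR_right
      to_complex_add to_complex_scaleR)

lemma norm_add_sq: "(norm (x + y))\<^sup>2 = (norm x)\<^sup>2 + 2 * re_ip x y + (norm y)\<^sup>2"
  by (simp add: re_ip_simps re_ip_commute flip: re_ip_same)

lemma re_ip_le: "re_ip x y \<le> norm x * norm y"
proof (cases "x = 0 \<or> y = 0")
  case True
  then show ?thesis using re_ip_simps(3)[of 0 x y] re_ip_simps(4)[of x 0 y] by auto
next
  case False
  have "0 \<le> (norm (norm y *\<^sub>R x + (- norm x) *\<^sub>R y))\<^sup>2" by simp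
  also have "\<dots> = 2 * (norm x * norm y) * (norm x * norm y - re_ip x y)"
    unfolding norm_add_sq re_ip_simps by (simp add: power2_eq_square algebra_simps)
  finally have "0 \<le> 2 * (norm x * norm y) * (norm x * norm y - re_ip x y)" .
  moreover have "0 < norm x * norm y" using False by simp
  ultimately show ?thesis by (smt (verit) mult_pos_neg)
qed

lemma norm_scale: "norm (scl c x) = norm c * norm x"
proof -
  have "(norm (scl c x))\<^sup>2 = norm (to_complex (ip (scl c x) (scl c x)))"
    by (simp add: to_complex_ip_same norm_power)
  also have "\<dots> = norm c * norm (to_complex (ip x (scl c x)))"
    by (simp add: ip_scale_left to_complex_mult norm_mult norm_to_complex)
  also have "\<dots> = norm c * (norm c * (norm x)\<^sup>2)"
    by (simp add: ip_commute[of x] ip_scale_left to_complex_mult norm_mult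
        to_complex_ip_same norm_power) (simp add: norm_to_complex)
  finally have "(norm (scl c x))\<^sup>2 = (norm c * norm x)\<^sup>2"
    by (simp add: power2_eq_square algebra_simps)
  then show ?thesis by simp
qed

text \<open>
  The scalar Cauchy-Schwarz inequality comes from its real part: multiplying \<open>x\<close> by the conjugate
  scalar \<open>ip y x\<close> turns \<open>ip x y\<close> into the real number \<open>\<bar>ip x y\<bar>\<^sup>2\<close>.
\<close>

lemma norm_ip_le: "norm (ip x y) \<le> norm x * norm y"
proof -
  let ?z = "to_complex (ip x y)"
  have conj: "to_complex (ip y x) = cnj ?z" by (rule ip_commute)
  have norm_z: "norm (ip x y) = norm ?z" "norm (ip y x) = norm ?z"
    by (simp_all add: norm_to_complex flip: conj) (metis complex_mod_cnj conj norm_to_complex)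
  have "(norm (ip x y))\<^sup>2 = re_ip (scl (ip y x) x) y"
    unfolding re_ip_def ip_scale_left to_complex_mult conj norm_z
    by (simp add: cmod_power2) (simp add: power2_eq_square)
  also have "\<dots> \<le> norm (scl (ip y x) x) * norm y" by (rule re_ip_le)
  also have "\<dots> = norm (ip x y) * (norm x * norm y)"
    by (simp add: norm_scale norm_z)
  finally show ?thesis
    by (cases "ip x y = 0") (simp_all add: power2_eq_square)
qed

lemma bounded_bilinear_ip: "bounded_bilinear ip"
proof
  show "\<exists>K. \<forall>x y. norm (ip x y) \<le> norm x * norm y * K"
    using norm_ip_le by (intro exI[of _ 1]) simp
qed (simp_all add: ip_add_left ip_add_right ip_scaleR_left ip_scaleR_right)

sublocale re_ip: bounded_bilinear re_ip
proof
  have "\<bar>re_ip x y\<bar> \<le> norm x * norm y" for x y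
    unfolding re_ip_def
    using order_trans[OF abs_Re_le_cmod] norm_ip_le by (metis norm_to_complex)
  then show "\<exists>K. \<forall>x y. norm (re_ip x y) \<le> norm x * norm y * K"
    by (intro exI[of _ 1]) simp
qed (simp_all add: re_ip_simps)

text \<open>This form exhibits the difference quotient of \<open>\<parallel>P z\<parallel>\<^sup>2\<close> as linear in that of \<open>z\<close>.\<close>

lemma norm_sq_diff: "(norm x)\<^sup>2 - (norm y)\<^sup>2 = re_ip (x - y) (x + y)"
  by (simp add: re_ip.diff_left re_ip.add_right re_ip_commute[of y x] flip: re_ip_same)

text \<open>Indeed \<open>y - P y\<close> is in the kernel of \<open>P\<close> and hence orthogonal to its range.\<close>

lemma orthogonal_projection_re_ip:
  assumes "orthogonal_projection scl ip P"
  shows "re_ip (P x) y = re_ip (P x) (P y)"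
proof -
  interpret bounded_linear P
    using assms by (simp add: orthogonal_projection_def bounded_operator_def)
  have "P (P y) = P y" using assms by (simp add: orthogonal_projection_def fun_eq_iff)
  then have "P (y - P y) = 0" by (simp add: diff)
  then have "ip (P x) (y - P y) = 0" using assms by (simp add: orthogonal_projection_def)
  then have "re_ip (P x) (y - P y) = 0"
    by (simp add: re_ip_def linear_0[OF bounded_linear.linear[OF bounded_linear_to_complex]])
  then show ?thesis by (simp add: re_ip.diff_right)
qed

end

section \<open>Dissipation and passivity\<close>

context hilbert_space
begin

text \<open>
  The operators \<open>S t\<close> need not be contractions, but they contract the seminorm \<open>\<parallel>P x\<parallel>\<close>. For \<open>x\<close> in the
  domain of the generator the hypothesis says that the right derivative of \<open>\<parallel>P (S t x)\<parallel>\<^sup>2\<close> is nonpositive;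
  the inequality then extends to the closure of the domain.
\<close>

lemma orbit_seminorm_decreasing:
  assumes S: "strongly_continuous_semigroup S" and P: "bounded_linear P"
    and diss: "\<And>x y. generator S x = Some y \<Longrightarrow> re_ip (P y) (P x) \<le> 0"
    and "0 \<le> t"
  shows "norm (P (S t x)) \<le> norm (P x)"
proof -
  interpret strongly_continuous_semigroup S by (rule S)
  interpret P: bounded_linear P by (rule P)
  interpret St: bounded_linear "S t" using \<open>0 \<le> t\<close> by (rule linear)
  have dom: "norm (P (S t x)) \<le> norm (P x)" if "generator S x = Some y" for x y
  proof -
    have "(norm (P (S t x)))\<^sup>2 \<le> (norm (P (S 0 x)))\<^sup>2"
    proof (rule le_if_right_quotients_nonpos[where \<phi> = "\<lambda>t. (norm (P (S t x)))\<^sup>2"])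
      show "continuous_on {0..t} (\<lambda>t. (norm (P (S t x)))\<^sup>2)"
        by (intro continuous_intros P.continuous_on orbit_continuous) auto
      fix r assume "0 \<le> r" "r < t"
      let ?z = "S r x"
      let ?g = "\<lambda>h. re_ip (P ((S h ?z - ?z) /\<^sub>R h)) (P (S h ?z) + P ?z)"
      have "generator S ?z = Some (S r y)" using that \<open>0 \<le> r\<close> by (rule generator_orbit)
      then have "(?g \<longlongrightarrow> re_ip (P (S r y)) (P ?z + P ?z)) (at_right 0)"
        unfolding generator_eq_Some_iff
        by (intro re_ip.tendsto P.tendsto tendsto_add right_continuous_0 tendsto_const)
      moreover have "re_ip (P (S r y)) (P ?z + P ?z) \<le> 0"
        using diss[OF \<open>generator S ?z = Some (S r y)\<close>] by (simp add: re_ip.add_right)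
      moreover have "\<forall>\<^sub>F h in at_right 0.
          (norm (P (S (r + h) x)))\<^sup>2 - (norm (P ?z))\<^sup>2 \<le> h * ?g h"
        using eventually_at_right_less[of 0]
      proof eventually_elim
        case (elim h)
        then have "S (r + h) x = S h ?z" using orbit_add[of h r x] \<open>0 \<le> r\<close> by (simp add: add.commute)
        moreover have "P (S h ?z) - P ?z = h *\<^sub>R P ((S h ?z - ?z) /\<^sub>R h)"
          using elim by (simp add: P.scaleR P.diff)
        ultimately show ?case by (simp add: norm_sq_diff re_ip.scaleR_left)
      qed
      ultimately show "\<exists>g L. (g \<longlongrightarrow> L) (at_right 0) \<and> L \<le> 0 \<and>
          (\<forall>\<^sub>F h in at_right 0. (norm (P (S (r + h) x)))\<^sup>2 - (norm (P ?z))\<^sup>2 \<le> h * g h)"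
        by blast
    qed (rule \<open>0 \<le> t\<close>)
    then show ?thesis by (simp add: at_0)
  qed
  have "closed {x. norm (P (S t x)) \<le> norm (P x)}"
    by (intro closed_Collect_le continuous_intros P.continuous_on St.continuous_on)
  moreover have "dom (generator S) \<subseteq> {x. norm (P (S t x)) \<le> norm (P x)}"
    using dom by auto
  ultimately show ?thesis using generator_dense closure_minimal by blast
qed

text \<open>
  The energy \<open>\<parallel>P x(t)\<parallel>\<^sup>2\<close> grows no faster than twice the work done by \<open>f\<close>: without input it would
  not grow at all, and over a time \<open>h\<close> the input contributes \<open>w h \<approx> h f(t)\<close>, whose square is of second
  order and enters with the favourable sign.
\<close>

theorem energy_inequality:
  assumes S: "strongly_continuous_semigroup S" and P: "bounded_linear P"
    and contr: "\<And>t x. 0 \<le> t \<Longrightarrow> norm (P (S t x)) \<le> norm (P x)"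
    and f: "continuous_on {0..T} f" and "0 \<le> T"
  defines "x \<equiv> strongly_continuous_semigroup.duhamel S f"
  shows "(norm (P (x T)))\<^sup>2 \<le> 2 * integral {0..T} (\<lambda>t. re_ip (P (x t)) (P (f t)))"
proof -
  interpret strongly_continuous_semigroup S by (rule S)
  interpret P: bounded_linear P by (rule P)
  have x: "continuous_on {0..T} x" unfolding x_def by (rule duhamel_continuous[OF f])
  define p where "p t = re_ip (P (x t)) (P (f t))" for t
  have p: "continuous_on {0..T} p"
    unfolding p_def by (intro re_ip.continuous_on P.continuous_on x f)
  define \<phi> where "\<phi> t = (norm (P (x t)))\<^sup>2 - 2 * integral {0..t} p" for t
  have "\<phi> T \<le> \<phi> 0"
  proof (rule le_if_right_quotients_nonpos[OF \<open>0 \<le> T\<close>])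
    show "continuous_on {0..T} \<phi>"
      unfolding \<phi>_def by (intro continuous_intros P.continuous_on x
          indefinite_integral_continuous_1 integrable_continuous_real p)
    fix t assume t: "0 \<le> t" "t < T"
    define w where "w h = integral {t..t + h} (\<lambda>s. S (t + h - s) (f s))" for h
    let ?g = "\<lambda>h. 2 * re_ip (P (x (t + h))) (P (w h /\<^sub>R h))
        - 2 * ((integral {0..t + h} p - integral {0..t} p) /\<^sub>R h)"
    have ev: "\<forall>\<^sub>F h in at_right 0. h < T - t"
      using t by (intro order_tendstoD(2)[OF tendsto_ident_at]) simp
    have "((\<lambda>h. x (t + h)) \<longlongrightarrow> x t) (at_right 0)"
    proof (rule continuous_on_tendsto_compose[OF x])
      show "((\<lambda>h. t + h) \<longlongrightarrow> t) (at_right 0)" by (auto intro!: tendsto_eq_intros)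
      show "\<forall>\<^sub>F h in at_right 0. t + h \<in> {0..T}"
        using ev eventually_at_right_less[of 0] by eventually_elim (use t in auto)
    qed (use t in auto)
    moreover have "((\<lambda>h. w h /\<^sub>R h) \<longlongrightarrow> f t) (at_right 0)"
      unfolding w_def by (rule duhamel_increment_tendsto[OF f t])
    ultimately have "(?g \<longlongrightarrow> 2 * re_ip (P (x t)) (P (f t)) - 2 * p t) (at_right 0)"
      using t by (intro tendsto_diff tendsto_mult_left re_ip.tendsto P.tendsto
          integral_right_quotient_tendsto[OF p])
    then have "(?g \<longlongrightarrow> 0) (at_right 0)" by (simp add: p_def)
    moreover have "\<forall>\<^sub>F h in at_right 0. \<phi> (t + h) - \<phi> t \<le> h * ?g h"
      using ev eventually_at_right_less[of 0]
    proof eventually_elim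
      case (elim h)
      let ?a = "P (x (t + h))" and ?b = "P (w h)"
      have "x (t + h) = S h (x t) + w h"
        unfolding x_def w_def using elim t by (intro duhamel_add[OF f]) auto
      then have "P (S h (x t)) = ?a + (- 1) *\<^sub>R ?b" by (simp add: P.add)
      then have "(norm (P (S h (x t))))\<^sup>2 = (norm ?a)\<^sup>2 - 2 * re_ip ?a ?b + (norm ?b)\<^sup>2"
        by (simp only: norm_add_sq) (simp add: re_ip.minus_right)
      moreover have "(norm (P (S h (x t))))\<^sup>2 \<le> (norm (P (x t)))\<^sup>2"
        using elim by (intro power_mono contr) auto
      ultimately have "(norm ?a)\<^sup>2 - (norm (P (x t)))\<^sup>2 \<le> 2 * re_ip ?a ?b"
        using zero_le_power2[of "norm ?b"] by linarith
      moreover have "h * ?g h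
          = 2 * re_ip ?a ?b - 2 * (integral {0..t + h} p - integral {0..t} p)"
        using elim by (simp add: P.scaleR re_ip.scaleR_right field_simps)
      ultimately show ?case by (simp add: \<phi>_def)
    qed
    ultimately show "\<exists>g L. (g \<longlongrightarrow> L) (at_right 0) \<and> L \<le> 0 \<and>
        (\<forall>\<^sub>F h in at_right 0. \<phi> (t + h) - \<phi> t \<le> h * g h)"
      by blast
  qed
  moreover have "x 0 = 0" by (simp add: x_def duhamel_def)
  ultimately show ?thesis by (simp add: \<phi>_def P.zero flip: p_def)
qed

end

lemma C0_semigroup_strongly_continuous:
  "C0_semigroup scl S \<Longrightarrow> strongly_continuous_semigroup S"
  by (auto simp: C0_semigroup_def bounded_operator_def strongly_continuous_semigroup_def)

theorem proposition14:
  fixes scl :: "'k::real_or_complex \<Rightarrow> 'h::banach \<Rightarrow> 'h"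
    and ip :: "'h \<Rightarrow> 'h \<Rightarrow> 'k"
    and A :: "'h \<rightharpoonup> 'h"
    and P :: "'h \<Rightarrow> 'h"
  assumes "hilbert_space scl ip"
    and "\<exists>S. generates scl A S"
    and "orthogonal_projection scl ip P"
    and "\<forall>x\<in>dom A. Re (to_complex (ip (P (the (A x))) x)) \<le> 0"
  shows "locally_passive scl ip A P"
proof -
  interpret hilbert_space scl ip by (rule assms(1))
  interpret P: bounded_linear P
    using assms(3) by (simp add: orthogonal_projection_def bounded_operator_def)
  note proj = orthogonal_projection_re_ip[OF assms(3)]
  show ?thesis
    unfolding locally_passive_def
  proof (intro allI impI)
    fix S T and u :: "real \<Rightarrow> 'h"
    assume gen: "generates scl A S" and "0 < (T::real)" and u: "continuous_on {0..T} u"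
    have S: "strongly_continuous_semigroup S" and A: "generator S = A"
      using gen by (auto simp: generates_def intro: C0_semigroup_strongly_continuous)
    interpret strongly_continuous_semigroup S by (rule S)
    have diss: "re_ip (P y) (P x) \<le> 0" if "generator S x = Some y" for x y
      using assms(4) that A proj[of y x] by (force simp: re_ip_def)
    let ?f = "\<lambda>s. P (u s)"
    have f: "continuous_on {0..T} ?f" by (intro P.continuous_on u)
    let ?x = "duhamel ?f"
    have "work ip S P T u = Re (to_complex (integral {0..T} (\<lambda>t. ip (?x t) (?f t))))"
      by (simp add: work_def mild_solution_def duhamel_def)
    also have "\<dots> = integral {0..T} (\<lambda>t. re_ip (?x t) (?f t))"
      using integral_linear[OF integrable_continuous_real
          bounded_linear_compose[OF bounded_linear_Re bounded_linear_to_complex],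
          OF bounded_bilinear.continuous_on[OF bounded_bilinear_ip duhamel_continuous[OF f] f]]
      by (simp add: o_def re_ip_def)
    also have "\<dots> = integral {0..T} (\<lambda>t. re_ip (P (?x t)) (P (?f t)))"
    proof (rule integral_cong)
      fix t
      have "P (?f t) = ?f t" using assms(3) by (simp add: orthogonal_projection_def fun_eq_iff)
      then show "re_ip (?x t) (?f t) = re_ip (P (?x t)) (P (?f t))"
        by (metis proj re_ip_commute)
    qed
    also have "0 \<le> \<dots>"
    proof -
      have "norm (P (S t x)) \<le> norm (P x)" if "0 \<le> t" for t x
        using orbit_seminorm_decreasing[OF S P.bounded_linear_axioms diss that] .
      then have "(norm (P (?x T)))\<^sup>2 \<le> 2 * integral {0..T} (\<lambda>t. re_ip (P (?x t)) (P (?f t)))"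
        by (rule energy_inequality[OF S P.bounded_linear_axioms _ f less_imp_le[OF \<open>0 < T\<close>]])
      then show ?thesis using zero_le_power2[of "norm (P (?x T))"] by linarith
    qed
    finally show "0 \<le> work ip S P T u" .
  qed
qed

end
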